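(* Let $\mathbb F_q$ be a finite field of odd characteristic and fix a nonsquare $\sigma\in\mathbb F_q^{\ast}$. Of all the $q^3(q^2-1)$ distinct quadratic rational expressions over $\mathbb F_q$, precisely $q^2(q^2-1)(q+1)/2$ are equivalent (over $\mathbb F_q$) to $x^2$, and precisely $q^2(q^2-1)(q-1)/2$ are equivalent (over $\mathbb F_q$) to $(x^2+\sigma)/(2x)$.
   Context: A rational expression $R(x)=g(x)/h(x)\in K(x)$ with $g,h$ coprime has degree $\max(\deg g,\deg h)$; quadratic means degree $2$. The group $G(K)=\mathrm{PGL}_2(K)\times\mathrm{PGL}_2(K)$, with $\mathrm{PGL}_2(K)$ identified with the group of degree-one rational expressions (Möbius transformations) under composition, acts on $K(x)$ by $(B,A)\cdot R(x)=B(R(A^{-1}(x)))$. Two rational expressions are called equivalent (over $K$) if they lie in the same $G(K)$-orbit. *)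

theory Defs
  imports
    "HOL-Computational_Algebra.Computational_Algebra"
    "HOL-Algebra.Group_Action"
    "HOL-Library.Cardinality"
begin

text \<open>The field \<open>K(x)\<close> is the type \<open>'a poly fract\<close>.\<close>

definition rat_const :: "'a::field \<Rightarrow> 'a poly fract" where
  "rat_const c = Fract [:c:] 1"

definition rat_X :: "'a::field poly fract" where
  "rat_X = Fract [:0, 1:] 1"

text \<open>
  A coprime pair representing \<open>R\<close> is unique up to a common nonzero constant factor, so the degree
  and the composition below do not depend on the choice made here. (The library's
  \<open>quot_of_fract\<close> is not available for polynomials over an arbitrary field type, because it
  needs a gcd on the polynomials.)
\<close>

definition lowest_terms :: "'a::field poly fract \<Rightarrow> 'a poly \<times> 'a poly" where
  "lowest_terms R = (SOME p. snd p \<noteq> 0 \<and> coprime (fst p) (snd p) \<and> R = Fract (fst p) (snd p))"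

definition rat_degree :: "'a::field poly fract \<Rightarrow> nat" where
  "rat_degree R = max (degree (fst (lowest_terms R))) (degree (snd (lowest_terms R)))"

definition poly_subst :: "'a::field poly \<Rightarrow> 'a poly fract \<Rightarrow> 'a poly fract" where
  "poly_subst p S = poly (map_poly rat_const p) S"

text \<open>
  \<open>rat_compose R S\<close> is \<open>R(S(x))\<close>. The denominator can vanish only if \<open>S\<close> is a constant that is a
  pole of \<open>R\<close>; \<open>K(x)\<close> has no element \<open>\<infinity>\<close>, and the value is then \<open>0\<close>. This does not happen for the
  expressions of positive degree, which are closed under composition.
\<close>

definition rat_compose :: "'a::field poly fract \<Rightarrow> 'a poly fract \<Rightarrow> 'a poly fract" where
  "rat_compose R S =
     poly_subst (fst (lowest_terms R)) S / poly_subst (snd (lowest_terms R)) S"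

definition PGL2 :: "'a::field poly fract monoid" where
  "PGL2 = \<lparr>carrier = {A. rat_degree A = 1}, mult = rat_compose, one = rat_X\<rparr>"

definition rat_act :: "'a::field poly fract \<times> 'a poly fract \<Rightarrow> 'a poly fract \<Rightarrow> 'a poly fract" where
  "rat_act = (\<lambda>(B, A) R. rat_compose B (rat_compose R (inv\<^bsub>PGL2\<^esub> A)))"

definition rat_equiv :: "'a::field poly fract \<Rightarrow> 'a poly fract \<Rightarrow> bool" where
  "rat_equiv R S \<longleftrightarrow> R \<in> orbit (PGL2 \<times>\<times> PGL2) rat_act S"

end

theory Submission
  imports Defs
begin

text \<open>
  Write a quadratic expression as \<open>R = g / h\<close> with coefficient vectors \<open>a, b \<in> K\<^sup>3\<close> and let
  \<open>(l, m, n)\<close> be the minors of the \<open>2 \<times> 3\<close> matrix \<open>(a, b)\<close>. The critical points of \<open>R\<close> are the roots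
  of \<open>l + 2 m x + n x\<^sup>2\<close>, and the resultant of \<open>g\<close> and \<open>h\<close> is \<open>m\<^sup>2 - l n\<close>, a quarter of the
  discriminant of this polynomial. Its square class is invariant under \<open>G(K)\<close>.
  If the critical points are rational (possibly \<open>\<infinity>\<close>), then \<open>g\<close> and \<open>h\<close> are combinations of the squares of the linear forms vanishing there, so \<open>R\<close> is
  equivalent to \<open>x\<^sup>2\<close>; otherwise an affine substitution moves them to the square roots of \<open>\<sigma>\<close> and
  \<open>g\<close>, \<open>h\<close> become combinations of \<open>x\<^sup>2 + \<sigma>\<close> and \<open>2 x\<close>. It remains to count the vectors
  \<open>(l, m, n)\<close> for which \<open>m\<^sup>2 - l n\<close> lies in a given square class: each is the vector of minors
  of \<open>q\<^sup>3 - q\<close> pairs \<open>(a, b)\<close>, and \<open>q - 1\<close> pairs give the same \<open>R\<close>.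
\<close>

subsection \<open>Fractions of polynomials over a field\<close>

text \<open>The Euclidean algorithm, as an induction on the size of \<open>h\<close>. The cofactors
  \<open>g'\<close> and \<open>h'\<close> record that the combination divides both polynomials, so
  it serves as their greatest common divisor.\<close>

lemma poly_bezout:
  fixes g h :: "'a::field poly"
  shows "\<exists>u v g' h'. g = (u * g + v * h) * g' \<and> h = (u * g + v * h) * h'"
proof (induction "euclidean_size h" arbitrary: g h rule: less_induct)
  case less
  show ?case
  proof (cases "h = 0")
    case True
    then have "g = (1 * g + 0 * h) * 1 \<and> h = (1 * g + 0 * h) * 0" by simp
    then show ?thesis by blast
  next
    case False
    then have "euclidean_size (g mod h) < euclidean_size h" by (rule mod_size_less)
    from less[OF this] obtain u v a b
      where ab: "h = (u * h + v * (g mod h)) * a" "g mod h = (u * h + v * (g mod h)) * b"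
      by blast
    define d where "d = u * h + v * (g mod h)"
    have g: "g = g div h * h + g mod h" by simp
    have "g mod h = g - g div h * h" by (simp add: minus_div_mult_eq_mod)
    then have d: "d = v * g + (u - v * (g div h)) * h"
      unfolding d_def by algebra
    have "h = d * a" "g mod h = d * b" using ab by (simp_all add: d_def)
    then have "g = d * (g div h * a + b)" using g by (metis distrib_left mult.left_commute)
    with \<open>h = d * a\<close> show ?thesis unfolding d by blast
  qed
qed

lemma coprime_poly_bezout:
  fixes g h :: "'a::field poly"
  assumes "coprime g h"
  obtains u v where "u * g + v * h = 1"
proof -
  from poly_bezout[of g h] obtain u v g' h'
    where "g = (u * g + v * h) * g'" "h = (u * g + v * h) * h'" by blast
  then have "(u * g + v * h) dvd g" "(u * g + v * h) dvd h" by (metis dvd_triv_left)+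
  with assms have "(u * g + v * h) dvd 1" by (meson coprime_common_divisor)
  then obtain w where "1 = (u * g + v * h) * w" by (elim dvdE)
  then have "(w * u) * g + (w * v) * h = 1" by (simp add: algebra_simps)
  then show ?thesis by (rule that)
qed

text \<open>A common divisor divides the nonzero constant \<open>r\<close>, a unit of K[x].
  Determinants and resultants later play the role of \<open>r\<close>.\<close>

lemma coprime_poly_if_combination_const:
  fixes g h :: "'a::field poly"
  assumes "u * g + v * h = [:r:]" "r \<noteq> 0"
  shows "coprime g h"
proof (rule coprimeI)
  fix d assume "d dvd g" "d dvd h"
  then have "d dvd [:r:]" using assms(1) by (metis dvd_add dvd_mult)
  moreover have "[:r:] dvd 1" using assms(2) by (simp add: is_unit_poly_iff dvd_field_iff)
  ultimately show "d dvd 1" by (rule dvd_trans)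
qed

lemma coprime_poly_dvd_mult:
  fixes g h :: "'a::field poly"
  assumes "coprime g h" "g dvd h * p"
  shows "g dvd p"
proof -
  from coprime_poly_bezout[OF assms(1)] obtain u v where uv: "u * g + v * h = 1" .
  have "p = (u * g + v * h) * p" by (simp add: uv)
  also have "\<dots> = g * (u * p) + v * (h * p)" by (simp add: algebra_simps)
  finally have "p = g * (u * p) + v * (h * p)" .
  moreover have "g dvd g * (u * p) + v * (h * p)" using assms(2) by simp
  ultimately show ?thesis by simp
qed

text \<open>Dividing by the Bezout combination leaves a coprime pair, so the choice in
  \<open>lowest_terms\<close> has a witness.\<close>

lemma exists_lowest_terms:
  fixes R :: "'a::field poly fract"
  shows "\<exists>p. snd p \<noteq> 0 \<and> coprime (fst p) (snd p) \<and> R = Fract (fst p) (snd p)"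
proof -
  obtain a b where R: "R = Fract a b" and b: "b \<noteq> 0" by (cases R)
  from poly_bezout[of a b] obtain u v g h
    where e: "a = (u * a + v * b) * g" "b = (u * a + v * b) * h" by blast
  define d where "d = u * a + v * b"
  have a': "a = d * g" and b': "b = d * h" using e by (simp_all add: d_def)
  have d0: "d \<noteq> 0" and h0: "h \<noteq> 0" using b b' by auto
  have "d * (u * g + v * h) = d" unfolding d_def[symmetric]
    by (metis a' b' d_def distrib_left mult.left_commute)
  then have "u * g + v * h = [:1:]" using d0 by (simp add: one_pCons[symmetric])
  then have "coprime g h" by (rule coprime_poly_if_combination_const) simp
  moreover have "R = Fract g h" unfolding R a' b' using d0 h0 by (simp add: eq_fract)
  ultimately show ?thesis using h0 by (intro exI[of _ "(g, h)"]) simp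
qed

text \<open>By cross-multiplication and coprimality \<open>h\<close> and \<open>h'\<close> divide
  each other, so they differ by a unit of K[x], a nonzero constant. This scalar ambiguity is counted
  later.\<close>

lemma Fract_eq_coprime:
  fixes g h g' h' :: "'a::field poly"
  assumes "coprime g h" "h \<noteq> 0" "coprime g' h'" "h' \<noteq> 0"
  shows "Fract g h = Fract g' h' \<longleftrightarrow> (\<exists>k. k \<noteq> 0 \<and> g' = smult k g \<and> h' = smult k h)"
proof
  assume "Fract g h = Fract g' h'"
  then have e: "g * h' = g' * h" using assms by (simp add: eq_fract)
  have "h dvd g * h'" "h' dvd g' * h" using e by (metis dvd_triv_right)+
  then have "h dvd h'" "h' dvd h"
    using assms(1,3) coprime_poly_dvd_mult coprime_commute by blast+
  then obtain w w' where w: "h' = h * w" "h = h' * w'" unfolding dvd_def by blast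
  then have "h * (w * w') = h * 1" by (metis mult.assoc mult.right_neutral)
  then have "w * w' = 1" using assms(2) by simp
  then have "w dvd 1" by (metis dvd_triv_left)
  then obtain k where k: "w = [:k:]" by (auto simp: is_unit_poly_iff)
  then have "k \<noteq> 0" using w assms(4) by auto
  have h': "h' = smult k h" using w k by simp
  have "h * smult k g = h * g'" using e unfolding h' by (simp add: mult.commute)
  then have "g' = smult k g" using assms(2) by (metis mult_cancel_left)
  with h' \<open>k \<noteq> 0\<close> show "\<exists>k. k \<noteq> 0 \<and> g' = smult k g \<and> h' = smult k h" by blast
next
  assume "\<exists>k. k \<noteq> 0 \<and> g' = smult k g \<and> h' = smult k h"
  then show "Fract g h = Fract g' h'" using assms by (auto simp: eq_fract mult.commute)
qed

lemma lowest_terms_Fract: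
  fixes g h :: "'a::field poly"
  assumes "coprime g h" "h \<noteq> 0"
  obtains k where "k \<noteq> 0" "lowest_terms (Fract g h) = (smult k g, smult k h)"
proof -
  define p where "p = lowest_terms (Fract g h)"
  have p: "snd p \<noteq> 0 \<and> coprime (fst p) (snd p) \<and> Fract g h = Fract (fst p) (snd p)"
    unfolding p_def lowest_terms_def by (rule someI_ex[OF exists_lowest_terms])
  then obtain k where "k \<noteq> 0" "fst p = smult k g" "snd p = smult k h"
    using Fract_eq_coprime[OF assms] by blast
  then show ?thesis using that[of k] by (simp add: p_def prod_eq_iff)
qed

lemma rat_degree_Fract:
  fixes g h :: "'a::field poly"
  assumes "coprime g h" "h \<noteq> 0"
  shows "rat_degree (Fract g h) = max (degree g) (degree h)"
proof -
  obtain k where "k \<noteq> 0" "lowest_terms (Fract g h) = (smult k g, smult k h)"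
    using lowest_terms_Fract[OF assms] .
  then show ?thesis by (simp add: rat_degree_def)
qed

lemma rat_degree_obtain:
  fixes R :: "'a::field poly fract"
  obtains g h where "R = Fract g h" "coprime g h" "h \<noteq> 0"
    "rat_degree R = max (degree g) (degree h)"
  using exists_lowest_terms[of R] rat_degree_Fract by (metis)

section \<open>Substitution and composition of rational expressions\<close>

lemma poly_subst_0 [simp]: "poly_subst 0 S = 0"
  by (simp add: poly_subst_def)

lemma poly_subst_pCons [simp]: "poly_subst (pCons a p) S = rat_const a + S * poly_subst p S"
  by (simp add: poly_subst_def map_poly_pCons rat_const_def Zero_fract_def)

lemma rat_const_mult: "rat_const (a * b) = rat_const a * rat_const b"
  by (simp add: rat_const_def mult.commute)

lemma poly_subst_smult: "poly_subst (smult k p) S = rat_const k * poly_subst p S"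
  by (induction p) (auto simp: rat_const_mult algebra_simps)

lemma rat_const_eq_0_iff: "rat_const k = 0 \<longleftrightarrow> k = 0"
  by (simp add: rat_const_def Zero_fract_def eq_fract)

lemma rat_compose_Fract:
  fixes g h :: "'a::field poly"
  assumes "coprime g h" "h \<noteq> 0"
  shows "rat_compose (Fract g h) S = poly_subst g S / poly_subst h S"
proof -
  obtain k where "k \<noteq> 0" "lowest_terms (Fract g h) = (smult k g, smult k h)"
    using lowest_terms_Fract[OF assms] .
  then show ?thesis by (simp add: rat_compose_def poly_subst_smult rat_const_eq_0_iff)
qed

subsection \<open>Moebius transformations\<close>

text \<open>The common denominator \<open>v\<close> cancels in the quotient. If the new denominator
  is the zero polynomial, both sides are \<open>0\<close> by the conventions for
  \<open>Fract\<close> and division.\<close>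

lemma rat_compose_Fract_linear:
  fixes u v :: "'a::field poly"
  assumes "coprime [:b, a:] [:d, c:]" "[:d, c:] \<noteq> 0" "v \<noteq> 0"
  shows "rat_compose (Fract [:b, a:] [:d, c:]) (Fract u v)
       = Fract (smult a u + smult b v) (smult c u + smult d v)"
proof -
  have s: "poly_subst [:b, a:] (Fract u v) = Fract (smult a u + smult b v) v" for a b
    using \<open>v \<noteq> 0\<close> by (simp add: rat_const_def Zero_fract_def eq_fract algebra_simps)
  show ?thesis unfolding rat_compose_Fract[OF assms(1,2)] s
    using \<open>v \<noteq> 0\<close> by (simp add: mult_fract_cancel mult.commute[of _ v])
qed

lemma rat_compose_Fract_quadratic:
  fixes u v :: "'a::field poly"
  assumes "coprime [:a0, a1, a2:] [:b0, b1, b2:]" "[:b0, b1, b2:] \<noteq> 0" "v \<noteq> 0"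
  shows "rat_compose (Fract [:a0, a1, a2:] [:b0, b1, b2:]) (Fract u v)
       = Fract (smult a0 (v * v) + smult a1 (u * v) + smult a2 (u * u))
               (smult b0 (v * v) + smult b1 (u * v) + smult b2 (u * u))"
proof -
  have s: "poly_subst [:a0, a1, a2:] (Fract u v)
         = Fract (smult a0 (v * v) + smult a1 (u * v) + smult a2 (u * u)) (v * v)" for a0 a1 a2
    using \<open>v \<noteq> 0\<close> by (simp add: rat_const_def Zero_fract_def eq_fract algebra_simps)
  show ?thesis unfolding rat_compose_Fract[OF assms(1,2)] s
    using \<open>v \<noteq> 0\<close> by (simp add: mult_fract_cancel mult.commute[of _ "v * v"])
qed

lemma degree_1_cases:
  fixes g h :: "'a::field poly"
  assumes "max (degree g) (degree h) \<le> 1"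
  obtains a b c d where "g = [:b, a:]" "h = [:d, c:]"
proof -
  have "\<exists>a b. p = [:b, a:]" if "degree p \<le> 1" for p :: "'a poly"
  proof (intro exI)
    show "p = [:coeff p 0, coeff p 1:]" using that
      by (intro poly_eqI) (auto simp: coeff_pCons coeff_eq_0 split: nat.splits)
  qed
  with assms show ?thesis using that by (metis max.bounded_iff)
qed

lemma degree_2_cases:
  fixes g h :: "'a::field poly"
  assumes "max (degree g) (degree h) \<le> 2"
  obtains a0 a1 a2 b0 b1 b2 where "g = [:a0, a1, a2:]" "h = [:b0, b1, b2:]"
proof -
  have "\<exists>a0 a1 a2. p = [:a0, a1, a2:]" if "degree p \<le> 2" for p :: "'a poly"
  proof (intro exI)
    show "p = [:coeff p 0, coeff p 1, coeff p 2:]" using that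
      by (intro poly_eqI) (auto simp: coeff_pCons coeff_eq_0 numeral_2_eq_2 split: nat.splits)
  qed
  with assms show ?thesis using that by (metis max.bounded_iff)
qed

text \<open>One polynomial is a constant multiple of the other, so the latter is a unit by
  coprimality. This excludes degenerate determinants and resultants.\<close>

lemma coprime_proportional_imp_const:
  fixes g h :: "'a::field poly"
  assumes "coprime g h" "smult a h = smult b g" "a \<noteq> 0 \<or> b \<noteq> 0"
  shows "degree g = 0 \<and> degree h = 0"
proof -
  have *: "degree p = 0 \<and> degree r = 0"
    if "coprime p r" "smult a r = smult b p" "a \<noteq> 0" for p r :: "'a poly" and a b
  proof -
    have "r = smult (inverse a) (smult a r)" using that(3) by simp
    also have "\<dots> = smult (inverse a * b) p" by (simp add: that(2))
    finally have r: "r = smult (inverse a * b) p" .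
    have "p dvd r" by (subst r) (rule dvd_smult, simp)
    then have "p dvd 1" using that(1) by (meson coprime_common_divisor dvd_refl)
    then have "degree p = 0" by (auto simp: is_unit_poly_iff)
    moreover have "degree r \<le> degree p" by (subst r) (rule degree_smult_le)
    ultimately show ?thesis by simp
  qed
  show ?thesis using *[OF assms(1,2)] *[of h g b a] assms coprime_commute by metis
qed

lemma coprime_linear:
  fixes a b c d :: "'a::field"
  assumes "a * d - b * c \<noteq> 0"
  shows "coprime [:b, a:] [:d, c:]"
  by (rule coprime_poly_if_combination_const[where u = "[:- c:]" and v = "[:a:]" and r = "a * d - b * c"])
     (use assms in \<open>simp_all add: algebra_simps\<close>)

text \<open>The arguments are in matrix order, whereas the coefficient lists start with the constant
  term.\<close>

definition mobius :: "'a::field \<Rightarrow> 'a \<Rightarrow> 'a \<Rightarrow> 'a \<Rightarrow> 'a poly fract" where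
  "mobius a b c d = Fract [:b, a:] [:d, c:]"

text \<open>A vanishing determinant makes numerator and denominator proportional, which coprimality
  allows only for constants.\<close>

lemma rat_degree_eq_1_iff:
  fixes R :: "'a::field poly fract"
  shows "rat_degree R = 1 \<longleftrightarrow> (\<exists>a b c d. a * d - b * c \<noteq> 0 \<and> R = mobius a b c d)"
proof
  assume R: "rat_degree R = 1"
  obtain g h where gh: "R = Fract g h" "coprime g h" "h \<noteq> 0"
    "rat_degree R = max (degree g) (degree h)" by (rule rat_degree_obtain)
  then obtain a b c d where e: "g = [:b, a:]" "h = [:d, c:]"
    using R degree_1_cases by (metis order_refl)
  have nz: "a \<noteq> 0 \<or> c \<noteq> 0" using gh R e by (auto simp: split: if_splits)
  have "a * d - b * c \<noteq> 0"
  proof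
    assume "a * d - b * c = 0"
    then have "smult a h = smult c g" by (simp add: e algebra_simps)
    with nz gh(2) have "degree g = 0 \<and> degree h = 0" by (intro coprime_proportional_imp_const)
    with R gh(4) show False by simp
  qed
  with e gh show "\<exists>a b c d. a * d - b * c \<noteq> 0 \<and> R = mobius a b c d"
    by (auto simp: mobius_def)
next
  assume "\<exists>a b c d. a * d - b * c \<noteq> 0 \<and> R = mobius a b c d"
  then obtain a b c d where d: "a * d - b * c \<noteq> 0" and R: "R = mobius a b c d" by blast
  then have "[:d, c:] \<noteq> 0" by auto
  from rat_degree_Fract[OF coprime_linear[OF d] this] d show "rat_degree R = 1"
    by (auto simp: R mobius_def)
qed

lemma mobius_compose:
  fixes a b c d :: "'a::field"
  assumes "a * d - b * c \<noteq> 0" "a' * d' - b' * c' \<noteq> 0"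
  shows "rat_compose (mobius a b c d) (mobius a' b' c' d')
       = mobius (a * a' + b * c') (a * b' + b * d') (c * a' + d * c') (c * b' + d * d')"
proof -
  have "[:d, c:] \<noteq> 0" "[:d', c':] \<noteq> 0" using assms by auto
  then show ?thesis unfolding mobius_def
    by (subst rat_compose_Fract_linear[OF coprime_linear[OF assms(1)]]) (simp_all add: add.commute)
qed

lemma mobius_smult:
  fixes a b c d k :: "'a::field"
  assumes "a * d - b * c \<noteq> 0" "k \<noteq> 0"
  shows "mobius (k * a) (k * b) (k * c) (k * d) = mobius a b c d"
proof -
  have "[:d, c:] \<noteq> 0" "[:k * d, k * c:] \<noteq> 0" using assms by auto
  then show ?thesis unfolding mobius_def by (simp add: eq_fract algebra_simps)
qed

lemma rat_X_eq_mobius: "rat_X = mobius 1 0 0 1"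
  by (simp add: rat_X_def mobius_def one_pCons)

lemma mobius_in_PGL2:
  fixes a b c d :: "'a::field"
  assumes "a * d - b * c \<noteq> 0"
  shows "mobius a b c d \<in> carrier PGL2"
  using assms rat_degree_eq_1_iff[of "mobius a b c d"] unfolding PGL2_def by auto

lemma PGL2_E:
  fixes A :: "'a::field poly fract"
  assumes "A \<in> carrier PGL2"
  obtains a b c d where "a * d - b * c \<noteq> 0" "A = mobius a b c d"
  using assms rat_degree_eq_1_iff[of A] unfolding PGL2_def by auto

lemma det_mult_nonzero:
  fixes a b c d :: "'a::field"
  assumes "a * d - b * c \<noteq> 0" "a' * d' - b' * c' \<noteq> 0"
  shows "(a * a' + b * c') * (c * b' + d * d') - (a * b' + b * d') * (c * a' + d * c') \<noteq> 0"
proof -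
  have "(a * a' + b * c') * (c * b' + d * d') - (a * b' + b * d') * (c * a' + d * c')
      = (a * d - b * c) * (a' * d' - b' * c')" by algebra
  with assms show ?thesis by simp
qed

section \<open>The group of Moebius transformations and the orbit relation\<close>

lemma PGL2_simps [simp]: "mult PGL2 = rat_compose" "one PGL2 = rat_X"
  by (simp_all add: PGL2_def)

lemma group_PGL2: "group (PGL2 :: 'a::field poly fract monoid)"
proof (rule groupI, unfold PGL2_simps)
  fix x y :: "'a poly fract"
  assume "x \<in> carrier PGL2" "y \<in> carrier PGL2"
  then show "rat_compose x y \<in> carrier PGL2"
    by (elim PGL2_E, simp only: mobius_compose not_False_eq_True) (intro mobius_in_PGL2 det_mult_nonzero)
next
  show "(rat_X :: 'a poly fract) \<in> carrier PGL2"
    by (simp add: rat_X_eq_mobius mobius_in_PGL2)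
next
  fix x y z :: "'a poly fract"
  assume "x \<in> carrier PGL2" "y \<in> carrier PGL2" "z \<in> carrier PGL2"
  then show "rat_compose (rat_compose x y) z = rat_compose x (rat_compose y z)"
    by (elim PGL2_E, simp only: mobius_compose det_mult_nonzero not_False_eq_True)
      (simp add: algebra_simps)
next
  fix x :: "'a poly fract"
  assume "x \<in> carrier PGL2"
  then show "rat_compose rat_X x = x"
    by (elim PGL2_E) (simp add: rat_X_eq_mobius mobius_compose)
next
  fix x :: "'a poly fract"
  assume "x \<in> carrier PGL2"
  then obtain a b c d where D: "a * d - b * c \<noteq> 0" and x: "x = mobius a b c d"
    by (rule PGL2_E)
  have D': "d * a - (- b) * (- c) \<noteq> 0" using D by (simp add: mult.commute)
  \<comment> \<open>The inverse comes from the adjugate matrix: the product is the determinant times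
    the identity, with the scalar displayed so that \<open>mobius_smult\<close> removes it.\<close>
  have "rat_compose (mobius d (- b) (- c) a) x
      = mobius ((a * d - b * c) * 1) ((a * d - b * c) * 0) ((a * d - b * c) * 0) ((a * d - b * c) * 1)"
    unfolding x by (subst mobius_compose[OF D' D]) (simp add: algebra_simps)
  also have "\<dots> = rat_X" unfolding rat_X_eq_mobius by (rule mobius_smult) (use D in auto)
  finally show "\<exists>y\<in>carrier PGL2. rat_compose y x = rat_X"
    using mobius_in_PGL2[OF D'] by blast
qed

text \<open>The inverse in \<open>rat_act\<close> can be absorbed: as \<open>A\<close> runs through
  the group, so does its inverse.\<close>

lemma rat_equiv_iff:
  fixes R S :: "'a::field poly fract"
  shows "rat_equiv R S \<longleftrightarrow> (\<exists>B\<in>carrier PGL2. \<exists>C\<in>carrier PGL2. R = rat_compose B (rat_compose S C))"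
proof -
  interpret P: group "PGL2 :: 'a poly fract monoid" by (rule group_PGL2)
  have "rat_equiv R S \<longleftrightarrow>
    (\<exists>B\<in>carrier PGL2. \<exists>A\<in>carrier PGL2. R = rat_compose B (rat_compose S (inv\<^bsub>PGL2\<^esub> A)))"
    by (auto simp: rat_equiv_def orbit_def rat_act_def)
  also have "\<dots> \<longleftrightarrow> (\<exists>B\<in>carrier PGL2. \<exists>C\<in>carrier PGL2. R = rat_compose B (rat_compose S C))"
    by (metis P.inv_closed P.inv_inv)
  finally show ?thesis .
qed

subsection \<open>Quadratic expressions and their critical points\<close>

text \<open>The Sylvester determinant for formal degree two, so it also vanishes when both leading
  coefficients do.\<close>

definition resultant :: "'a::field \<Rightarrow> 'a \<Rightarrow> 'a \<Rightarrow> 'a \<Rightarrow> 'a \<Rightarrow> 'a \<Rightarrow> 'a" where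
  "resultant a0 a1 a2 b0 b1 b2
     = (a0 * b2 - a2 * b0)\<^sup>2 - (a0 * b1 - a1 * b0) * (a1 * b2 - a2 * b1)"

definition quad :: "'a::field \<Rightarrow> 'a \<Rightarrow> 'a \<Rightarrow> 'a \<Rightarrow> 'a \<Rightarrow> 'a \<Rightarrow> 'a poly fract" where
  "quad a0 a1 a2 b0 b1 b2 = Fract [:a0, a1, a2:] [:b0, b1, b2:]"

lemma coprime_quadratic:
  fixes a0 a1 a2 b0 b1 b2 :: "'a::field"
  assumes "resultant a0 a1 a2 b0 b1 b2 \<noteq> 0"
  shows "coprime [:a0, a1, a2:] [:b0, b1, b2:]"
proof -
  define m where "m = a0 * b2 - a2 * b0"
  define n where "n = a1 * b2 - a2 * b1"
  \<comment> \<open>With \<open>g\<close>, \<open>h\<close> for the two quadratics and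
    \<open>l = a0 * b1 - a1 * b0\<close>, one has \<open>b2 g - a2 h = m + n x\<close> and
    \<open>b1 g - a1 h = l - n x^2\<close>. The first times \<open>m - n x\<close> minus the second
    times \<open>n\<close> is \<open>m^2 - l n\<close>; this yields \<open>u\<close> and
    \<open>v\<close>.\<close>
  show ?thesis
    by (rule coprime_poly_if_combination_const[OF _ assms,
          where u = "[:m * b2 - n * b1, - n * b2:]" and v = "[:n * a1 - m * a2, n * a2:]"])
       (simp add: m_def n_def resultant_def algebra_simps power2_eq_square)
qed

lemma resultant_nonzero_denominator:
  assumes "resultant a0 a1 a2 b0 b1 b2 \<noteq> 0"
  shows "[:b0, b1, b2:] \<noteq> 0"
  using assms by (auto simp: resultant_def)

text \<open>The new numerator is
  \<open>a0 (r x + s)^2 + a1 (p x + q) (r x + s) + a2 (p x + q)^2\<close>, expanded; likewise the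
  denominator.\<close>

lemma quad_compose_mobius:
  fixes p q r s :: "'a::field"
  assumes "resultant a0 a1 a2 b0 b1 b2 \<noteq> 0" "p * s - q * r \<noteq> 0"
  shows "rat_compose (quad a0 a1 a2 b0 b1 b2) (mobius p q r s)
       = quad (a0 * s\<^sup>2 + a1 * q * s + a2 * q\<^sup>2)
              (2 * a0 * r * s + a1 * (p * s + q * r) + 2 * a2 * p * q)
              (a0 * r\<^sup>2 + a1 * p * r + a2 * p\<^sup>2)
              (b0 * s\<^sup>2 + b1 * q * s + b2 * q\<^sup>2)
              (2 * b0 * r * s + b1 * (p * s + q * r) + 2 * b2 * p * q)
              (b0 * r\<^sup>2 + b1 * p * r + b2 * p\<^sup>2)"
proof -
  have "[:s, r:] \<noteq> 0" using assms(2) by auto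
  then show ?thesis unfolding mobius_def quad_def
    by (subst rat_compose_Fract_quadratic[OF coprime_quadratic resultant_nonzero_denominator, OF assms(1,1)])
       (simp_all add: algebra_simps power2_eq_square)
qed

lemma mobius_compose_quad:
  fixes p q r s :: "'a::field"
  assumes "p * s - q * r \<noteq> 0" "resultant a0 a1 a2 b0 b1 b2 \<noteq> 0"
  shows "rat_compose (mobius p q r s) (quad a0 a1 a2 b0 b1 b2)
       = quad (p * a0 + q * b0) (p * a1 + q * b1) (p * a2 + q * b2)
              (r * a0 + s * b0) (r * a1 + s * b1) (r * a2 + s * b2)"
proof -
  have "[:s, r:] \<noteq> 0" using assms(1) by auto
  then show ?thesis unfolding mobius_def quad_def
    by (subst rat_compose_Fract_linear[OF coprime_linear[OF assms(1)] _
          resultant_nonzero_denominator[OF assms(2)]])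
       simp_all
qed

text \<open>The form \<open>l + 2 m x + n x^2\<close> undergoes the substitution and is also
  multiplied by the determinant; each effect contributes a squared determinant to the
  discriminant.\<close>

lemma resultant_right:
  fixes p q r s :: "'a::field"
  shows "resultant (a0 * s\<^sup>2 + a1 * q * s + a2 * q\<^sup>2)
              (2 * a0 * r * s + a1 * (p * s + q * r) + 2 * a2 * p * q)
              (a0 * r\<^sup>2 + a1 * p * r + a2 * p\<^sup>2)
              (b0 * s\<^sup>2 + b1 * q * s + b2 * q\<^sup>2)
              (2 * b0 * r * s + b1 * (p * s + q * r) + 2 * b2 * p * q)
              (b0 * r\<^sup>2 + b1 * p * r + b2 * p\<^sup>2)
     = ((p * s - q * r)\<^sup>2)\<^sup>2 * resultant a0 a1 a2 b0 b1 b2"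
  unfolding resultant_def by algebra

text \<open>Each minor is multiplied by the determinant, and the resultant is quadratic in the
  minors.\<close>

lemma resultant_left:
  fixes p q r s :: "'a::field"
  shows "resultant (p * a0 + q * b0) (p * a1 + q * b1) (p * a2 + q * b2)
              (r * a0 + s * b0) (r * a1 + s * b1) (r * a2 + s * b2)
     = (p * s - q * r)\<^sup>2 * resultant a0 a1 a2 b0 b1 b2"
  unfolding resultant_def by algebra

lemma rat_degree_eq_2_iff:
  fixes R :: "'a::field poly fract"
  shows "rat_degree R = 2 \<longleftrightarrow>
    (\<exists>a0 a1 a2 b0 b1 b2. resultant a0 a1 a2 b0 b1 b2 \<noteq> 0 \<and> R = quad a0 a1 a2 b0 b1 b2)"
proof
  assume R: "rat_degree R = 2"
  obtain g h where gh: "R = Fract g h" "coprime g h" "h \<noteq> 0"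
    "rat_degree R = max (degree g) (degree h)" by (rule rat_degree_obtain)
  then obtain a0 a1 a2 b0 b1 b2 where e: "g = [:a0, a1, a2:]" "h = [:b0, b1, b2:]"
    using R degree_2_cases by (metis order_refl)
  have nz: "a2 \<noteq> 0 \<or> b2 \<noteq> 0" using gh R e by (auto simp: split: if_splits)
  have "resultant a0 a1 a2 b0 b1 b2 \<noteq> 0"
  proof
    assume 0: "resultant a0 a1 a2 b0 b1 b2 = 0"
    define l where "l = a0 * b1 - a1 * b0"
    define m where "m = a0 * b2 - a2 * b0"
    define n where "n = a1 * b2 - a2 * b1"
    have mn: "m * m = l * n" using 0 by (simp add: resultant_def l_def m_def n_def power2_eq_square)
    have *: "smult a2 h = smult b2 g \<Longrightarrow> False"
      using coprime_proportional_imp_const[OF gh(2)] nz R gh(4) by auto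
    \<comment> \<open>Up to the sign of \<open>v\<close> these are the cofactors from
      \<open>coprime_quadratic\<close>, so a zero resultant gives \<open>u * g = v * h\<close>.
      Coprimality makes \<open>g\<close> divide \<open>v\<close> and \<open>h\<close> divide
      \<open>u\<close>; since \<open>g\<close> or \<open>h\<close> has degree two, both
      \<open>u\<close> and \<open>v\<close> vanish.\<close>
    define u where "u = [:m * b2 - n * b1, - n * b2:]"
    define v where "v = [:m * a2 - n * a1, - n * a2:]"
    have "u * g - v * h = [:m * m - l * n:]"
      by (simp add: u_def v_def e l_def m_def n_def algebra_simps)
    with mn have eq: "u * g = v * h" by simp
    then have "g dvd h * v" "h dvd g * u" by (metis dvd_triv_right mult.commute)+
    then have "g dvd v" "h dvd u"
      using gh(2) coprime_poly_dvd_mult coprime_commute by blast+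
    moreover have "degree u \<le> 1" "degree v \<le> 1" by (simp_all add: u_def v_def)
    ultimately have "v = 0 \<or> degree g \<le> 1" "u = 0 \<or> degree h \<le> 1"
      by (auto dest!: dvd_imp_degree_le)
    moreover have "g \<noteq> 0" "h \<noteq> 0" using R gh(2,3,4) by (auto simp: is_unit_iff_degree)
    ultimately have "v = 0" "u = 0" using eq R gh(4) by auto
    then have "n * a2 = 0" "n * b2 = 0" "m * a2 = n * a1" "m * b2 = n * b1"
      by (simp_all add: u_def v_def)
    with nz have "n = 0" "m = 0" by auto
    \<comment> \<open>This is the identity \<open>b2 g - a2 h = m + n x\<close> once more.\<close>
    then have "smult a2 h = smult b2 g" by (simp add: e m_def n_def algebra_simps)
    then show False by (rule *)
  qed
  with e gh(1) show "\<exists>a0 a1 a2 b0 b1 b2. resultant a0 a1 a2 b0 b1 b2 \<noteq> 0 \<and> R = quad a0 a1 a2 b0 b1 b2"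
    unfolding quad_def by blast
next
  assume "\<exists>a0 a1 a2 b0 b1 b2. resultant a0 a1 a2 b0 b1 b2 \<noteq> 0 \<and> R = quad a0 a1 a2 b0 b1 b2"
  then obtain a0 a1 a2 b0 b1 b2
    where d: "resultant a0 a1 a2 b0 b1 b2 \<noteq> 0" and R: "R = quad a0 a1 a2 b0 b1 b2" by blast
  from d have "a2 \<noteq> 0 \<or> b2 \<noteq> 0" by (auto simp: resultant_def)
  with rat_degree_Fract[OF coprime_quadratic resultant_nonzero_denominator, OF d d]
  show "rat_degree R = 2" by (auto simp: R quad_def)
qed

section \<open>Equality and equivalence of quadratic expressions\<close>

lemma quad_eq_iff:
  fixes a0 a1 a2 b0 b1 b2 :: "'a::field"
  assumes "resultant a0 a1 a2 b0 b1 b2 \<noteq> 0" "resultant a0' a1' a2' b0' b1' b2' \<noteq> 0"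
  shows "quad a0 a1 a2 b0 b1 b2 = quad a0' a1' a2' b0' b1' b2' \<longleftrightarrow>
    (\<exists>k. k \<noteq> 0 \<and> a0' = k * a0 \<and> a1' = k * a1 \<and> a2' = k * a2
       \<and> b0' = k * b0 \<and> b1' = k * b1 \<and> b2' = k * b2)"
  unfolding quad_def
  by (subst Fract_eq_coprime) (use assms in \<open>simp_all add: coprime_quadratic resultant_nonzero_denominator del: pCons_eq_0_iff\<close>)

lemma resultant_smult:
  fixes k :: "'a::field"
  shows "resultant (k * a0) (k * a1) (k * a2) (k * b0) (k * b1) (k * b2)
    = (k\<^sup>2)\<^sup>2 * resultant a0 a1 a2 b0 b1 b2"
  unfolding resultant_def by algebra

text \<open>The substitution and the rescaling of coefficients contribute fourth powers, the left
  Moebius transformation the square of its determinant.\<close>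

lemma rat_equiv_quadD:
  fixes a0 a1 a2 b0 b1 b2 :: "'a::field"
  assumes "resultant a0 a1 a2 b0 b1 b2 \<noteq> 0" "resultant c0 c1 c2 d0 d1 d2 \<noteq> 0"
    and "rat_equiv (quad a0 a1 a2 b0 b1 b2) (quad c0 c1 c2 d0 d1 d2)"
  shows "\<exists>k. k \<noteq> 0 \<and> resultant a0 a1 a2 b0 b1 b2 = k\<^sup>2 * resultant c0 c1 c2 d0 d1 d2"
proof -
  from assms(3) obtain B C where B: "B \<in> carrier PGL2" and C: "C \<in> carrier PGL2"
    and e: "quad a0 a1 a2 b0 b1 b2 = rat_compose B (rat_compose (quad c0 c1 c2 d0 d1 d2) C)"
    by (auto simp: rat_equiv_iff)
  from B obtain p q r s where B': "p * s - q * r \<noteq> 0" "B = mobius p q r s" by (rule PGL2_E)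
  from C obtain p' q' r' s' where C': "p' * s' - q' * r' \<noteq> 0" "C = mobius p' q' r' s'" by (rule PGL2_E)
  let ?S = "quad c0 c1 c2 d0 d1 d2"
  obtain e0 e1 e2 f0 f1 f2 where 1: "rat_compose ?S C = quad e0 e1 e2 f0 f1 f2"
    and 2: "resultant e0 e1 e2 f0 f1 f2 = ((p' * s' - q' * r')\<^sup>2)\<^sup>2 * resultant c0 c1 c2 d0 d1 d2"
    unfolding C'(2) quad_compose_mobius[OF assms(2) C'(1)] using resultant_right by blast
  have 3: "resultant e0 e1 e2 f0 f1 f2 \<noteq> 0" using 2 assms(2) C'(1) by simp
  obtain g0 g1 g2 h0 h1 h2 where 4: "rat_compose B (quad e0 e1 e2 f0 f1 f2) = quad g0 g1 g2 h0 h1 h2"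
    and 5: "resultant g0 g1 g2 h0 h1 h2 = (p * s - q * r)\<^sup>2 * resultant e0 e1 e2 f0 f1 f2"
    unfolding B'(2) mobius_compose_quad[OF B'(1) 3] using resultant_left by blast
  have 6: "resultant g0 g1 g2 h0 h1 h2 \<noteq> 0" using 5 3 B'(1) by simp
  have "quad g0 g1 g2 h0 h1 h2 = quad a0 a1 a2 b0 b1 b2" using e 1 4 by simp
  then obtain k where k: "k \<noteq> 0"
    "a0 = k * g0" "a1 = k * g1" "a2 = k * g2" "b0 = k * h0" "b1 = k * h1" "b2 = k * h2"
    unfolding quad_eq_iff[OF 6 assms(1)] by blast
  have "resultant a0 a1 a2 b0 b1 b2
      = (k\<^sup>2 * (p * s - q * r) * (p' * s' - q' * r')\<^sup>2)\<^sup>2 * resultant c0 c1 c2 d0 d1 d2"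
    unfolding k(2-) resultant_smult 5 2 by (simp only: power_mult_distrib mult.assoc)
  moreover have "k\<^sup>2 * (p * s - q * r) * (p' * s' - q' * r')\<^sup>2 \<noteq> 0" using k(1) B'(1) C'(1) by simp
  ultimately show ?thesis by blast
qed

text \<open>The criterion applied to both models: the \<open>e\<close> and \<open>f\<close>
  coefficients describe the model after a Moebius substitution, and the given numerator and
  denominator lie in their span.\<close>

lemma rat_equiv_quadI:
  fixes a0 a1 a2 b0 b1 b2 :: "'a::field"
  assumes "resultant a0 a1 a2 b0 b1 b2 \<noteq> 0" "resultant c0 c1 c2 d0 d1 d2 \<noteq> 0"
    and "p * s - q * r \<noteq> 0"
    and g: "[:a0, a1, a2:] = smult \<alpha> [:e0, e1, e2:] + smult \<beta> [:f0, f1, f2:]"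
    and h: "[:b0, b1, b2:] = smult \<gamma> [:e0, e1, e2:] + smult \<delta> [:f0, f1, f2:]"
    and e: "e0 = c0 * s\<^sup>2 + c1 * q * s + c2 * q\<^sup>2"
      "e1 = 2 * c0 * r * s + c1 * (p * s + q * r) + 2 * c2 * p * q"
      "e2 = c0 * r\<^sup>2 + c1 * p * r + c2 * p\<^sup>2"
    and f: "f0 = d0 * s\<^sup>2 + d1 * q * s + d2 * q\<^sup>2"
      "f1 = 2 * d0 * r * s + d1 * (p * s + q * r) + 2 * d2 * p * q"
      "f2 = d0 * r\<^sup>2 + d1 * p * r + d2 * p\<^sup>2"
  shows "rat_equiv (quad a0 a1 a2 b0 b1 b2) (quad c0 c1 c2 d0 d1 d2)"
proof -
  have 1: "rat_compose (quad c0 c1 c2 d0 d1 d2) (mobius p q r s) = quad e0 e1 e2 f0 f1 f2"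
    unfolding e f by (rule quad_compose_mobius[OF assms(2,3)])
  have 2: "resultant e0 e1 e2 f0 f1 f2 = ((p * s - q * r)\<^sup>2)\<^sup>2 * resultant c0 c1 c2 d0 d1 d2"
    unfolding e f by (rule resultant_right)
  have 3: "resultant e0 e1 e2 f0 f1 f2 \<noteq> 0" using 2 assms(2,3) by simp
  have 4: "a0 = \<alpha> * e0 + \<beta> * f0" "a1 = \<alpha> * e1 + \<beta> * f1" "a2 = \<alpha> * e2 + \<beta> * f2"
    "b0 = \<gamma> * e0 + \<delta> * f0" "b1 = \<gamma> * e1 + \<delta> * f1" "b2 = \<gamma> * e2 + \<delta> * f2"
    using g h by simp_all
  \<comment> \<open>By \<open>resultant_left\<close>, a zero determinant would force the given
    resultant to vanish.\<close>
  then have det: "\<alpha> * \<delta> - \<beta> * \<gamma> \<noteq> 0"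
    using assms(1) resultant_left by (metis mult_zero_left power_zero_numeral)
  have "quad a0 a1 a2 b0 b1 b2 = rat_compose (mobius \<alpha> \<beta> \<gamma> \<delta>) (quad e0 e1 e2 f0 f1 f2)"
    unfolding mobius_compose_quad[OF det 3] 4 ..
  then show ?thesis unfolding rat_equiv_iff 1[symmetric]
    using mobius_in_PGL2[OF det] mobius_in_PGL2[OF assms(3)] by blast
qed

section \<open>The two models and their square classes\<close>

lemma rat_X_square_eq_quad: "rat_X\<^sup>2 = quad 0 0 1 1 0 0"
  by (simp add: rat_X_def quad_def power2_eq_square one_pCons)

lemma degree_2_model_eq_quad:
  fixes \<sigma> :: "'a::field"
  assumes "(2::'a) \<noteq> 0"
  shows "(rat_X\<^sup>2 + rat_const \<sigma>) / (2 * rat_X) = quad \<sigma> 0 1 0 2 0"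
proof -
  have "(2 :: 'a poly fract) = Fract (of_nat 2) 1" unfolding Fract_of_nat_eq by simp
  also have "(of_nat 2 :: 'a poly) = [:2:]" by (metis of_nat_numeral numeral_poly)
  finally have 2: "(2 :: 'a poly fract) = Fract [:2:] 1" .
  show ?thesis unfolding 2
    by (simp add: rat_X_def rat_const_def quad_def power2_eq_square one_pCons)
qed

lemma quadratic_combination:
  fixes N :: "'a::field"
  assumes "N \<noteq> 0" "x0 * N = A * e0 + B * f0" "x1 * N = A * e1 + B * f1" "x2 * N = A * e2 + B * f2"
  shows "[:x0, x1, x2:] = smult (A / N) [:e0, e1, e2:] + smult (B / N) [:f0, f1, f2:]"
proof -
  have "x = (A / N) * e + (B / N) * f" if "x * N = A * e + B * f" for x e f
    using assms(1) that by (simp add: field_simps)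
  with assms show ?thesis by simp
qed

text \<open>The model has resultant 1, so equivalence forces a square. Conversely, a root
  \<open>t\<close> makes the critical points rational, and a substitution sends them to
  \<open>0\<close> and infinity, the critical points of the model.\<close>

lemma quad_equiv_square_iff:
  fixes a0 a1 a2 b0 b1 b2 :: "'a::field"
  assumes two: "(2::'a) \<noteq> 0" and res: "resultant a0 a1 a2 b0 b1 b2 \<noteq> 0"
  shows "rat_equiv (quad a0 a1 a2 b0 b1 b2) (rat_X\<^sup>2) \<longleftrightarrow> (\<exists>t. resultant a0 a1 a2 b0 b1 b2 = t\<^sup>2)"
proof
  assume "rat_equiv (quad a0 a1 a2 b0 b1 b2) (rat_X\<^sup>2)"
  from rat_equiv_quadD[OF res _ this[unfolded rat_X_square_eq_quad]]
  show "\<exists>t. resultant a0 a1 a2 b0 b1 b2 = t\<^sup>2" by (auto simp: resultant_def)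
next
  assume "\<exists>t. resultant a0 a1 a2 b0 b1 b2 = t\<^sup>2"
  then obtain t where t: "resultant a0 a1 a2 b0 b1 b2 = t\<^sup>2" by blast
  have t0: "t \<noteq> 0" using res t by auto
  define l where "l = a0 * b1 - a1 * b0"
  define m where "m = a0 * b2 - a2 * b0"
  define n where "n = a1 * b2 - a2 * b1"
  have lmn: "t * t = m * m - l * n" using t by (simp add: resultant_def l_def m_def n_def power2_eq_square)
  \<comment> \<open>Both coefficient vectors are orthogonal to their cross product
    \<open>(n, - m, l)\<close>.\<close>
  have pa: "a0 * n - a1 * m + a2 * l = 0" "b0 * n - b1 * m + b2 * l = 0"
    unfolding l_def m_def n_def by algebra+
  have ex: "resultant 0 0 1 1 0 (0::'a) \<noteq> 0" by (simp add: resultant_def)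
  show "rat_equiv (quad a0 a1 a2 b0 b1 b2) (rat_X\<^sup>2)"
  proof (cases "n = 0")
    case True
    have m0: "m \<noteq> 0" using lmn t0 True by auto
    \<comment> \<open>One critical point is infinity and the other is \<open>- q\<close>, so the
      squares are \<open>1\<close> and \<open>(x + q)^2\<close>.\<close>
    define q where "q = l / (2 * m)"
    have q: "a2 * l = 2 * a2 * q * m" "b2 * l = 2 * b2 * q * m" using two m0 by (simp_all add: q_def)
    have "a1 = 2 * a2 * q" "b1 = 2 * b2 * q" using pa q m0 True by simp_all
    then have row: "[:a0, a1, a2:] = smult a2 [:q\<^sup>2, 2 * q, 1:] + smult (a0 - a2 * q\<^sup>2) [:1, 0, 0:]"
      "[:b0, b1, b2:] = smult b2 [:q\<^sup>2, 2 * q, 1:] + smult (b0 - b2 * q\<^sup>2) [:1, 0, 0:]"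
      by simp_all
    have det: "1 * 1 - q * 0 \<noteq> 0" by simp
    show ?thesis unfolding rat_X_square_eq_quad
      by (rule rat_equiv_quadI[OF res ex det row]) simp_all
  next
    case False
    have "(4::'a) = 2 * 2" by simp
    then have n4: "4 * n * n * t \<noteq> 0" using two False t0 by (metis mult_eq_0_iff)
    \<comment> \<open>The squares are \<open>(n x + m - t)^2\<close> and
      \<open>(n x + m + t)^2\<close>. The two scalars solve the equations for \<open>x1\<close> and
      \<open>x2\<close>; the one for \<open>x0\<close> then follows from orthogonality and
      \<open>lmn\<close>.\<close>
    have row: "[:x0, x1, x2:]
       = smult ((2 * (m + t) * x2 - x1 * n) / (4 * n * n * t)) [:(m - t)\<^sup>2, 2 * n * (m - t), n\<^sup>2:]
       + smult ((x1 * n - 2 * (m - t) * x2) / (4 * n * n * t)) [:(m + t)\<^sup>2, 2 * n * (m + t), n\<^sup>2:]"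
      if x: "x0 * n - x1 * m + x2 * l = 0" for x0 x1 x2
    proof -
      have "x0 * (4 * n * n * t) = (2 * (m + t) * x2 - x1 * n) * (m - t)\<^sup>2
            + (x1 * n - 2 * (m - t) * x2) * (m + t)\<^sup>2"
        using x lmn by algebra
      moreover have "x1 * (4 * n * n * t) = (2 * (m + t) * x2 - x1 * n) * (2 * n * (m - t))
            + (x1 * n - 2 * (m - t) * x2) * (2 * n * (m + t))" by algebra
      moreover have "x2 * (4 * n * n * t) = (2 * (m + t) * x2 - x1 * n) * n\<^sup>2
            + (x1 * n - 2 * (m - t) * x2) * n\<^sup>2" by algebra
      ultimately show ?thesis by (intro quadratic_combination n4)
    qed
    have det: "n * (m + t) - (m - t) * n \<noteq> 0"
    proof -
      have "n * (m + t) - (m - t) * n = 2 * (n * t)" by algebra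
      then show ?thesis using two False t0 by simp
    qed
    show ?thesis unfolding rat_X_square_eq_quad
      by (rule rat_equiv_quadI[OF res ex det row[OF pa(1)] row[OF pa(2)]]) simp_all
  qed
qed

text \<open>The model has resultant \<open>4 \<sigma>\<close>, which gives one direction. For the
  other, the substitution \<open>(n x + m) / t\<close> sends the critical points to the square roots
  of \<sigma>, where the model has its own.\<close>

lemma quad_equiv_nonsquare_iff:
  fixes a0 a1 a2 b0 b1 b2 \<sigma> :: "'a::field"
  assumes two: "(2::'a) \<noteq> 0" and res: "resultant a0 a1 a2 b0 b1 b2 \<noteq> 0"
    and \<sigma>: "\<nexists>y. \<sigma> = y\<^sup>2"
  shows "rat_equiv (quad a0 a1 a2 b0 b1 b2) ((rat_X\<^sup>2 + rat_const \<sigma>) / (2 * rat_X))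
    \<longleftrightarrow> (\<exists>t. resultant a0 a1 a2 b0 b1 b2 = \<sigma> * t\<^sup>2)"
proof
  have ex: "resultant \<sigma> 0 1 0 2 0 = 2\<^sup>2 * \<sigma>" by (simp add: resultant_def)
  have "\<sigma> \<noteq> 0" using \<sigma> by (metis zero_power2)
  then have ex0: "resultant \<sigma> 0 1 0 2 0 \<noteq> 0" unfolding ex using two by (metis mult_eq_0_iff power_not_zero)
  {
    assume "rat_equiv (quad a0 a1 a2 b0 b1 b2) ((rat_X\<^sup>2 + rat_const \<sigma>) / (2 * rat_X))"
    from rat_equiv_quadD[OF res ex0 this[unfolded degree_2_model_eq_quad[OF two]]]
    obtain k where "resultant a0 a1 a2 b0 b1 b2 = \<sigma> * (k * 2)\<^sup>2"
      unfolding ex power_mult_distrib by (auto simp: mult_ac)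
    then show "\<exists>t. resultant a0 a1 a2 b0 b1 b2 = \<sigma> * t\<^sup>2" by blast
  next
    assume "\<exists>t. resultant a0 a1 a2 b0 b1 b2 = \<sigma> * t\<^sup>2"
    then obtain t where t: "resultant a0 a1 a2 b0 b1 b2 = \<sigma> * t\<^sup>2" by blast
    have t0: "t \<noteq> 0" using res t by auto
    define l where "l = a0 * b1 - a1 * b0"
    define m where "m = a0 * b2 - a2 * b0"
    define n where "n = a1 * b2 - a2 * b1"
    have lmn: "\<sigma> * t\<^sup>2 = m * m - l * n" using t by (simp add: resultant_def l_def m_def n_def power2_eq_square)
    have pa: "a0 * n - a1 * m + a2 * l = 0" "b0 * n - b1 * m + b2 * l = 0"
      unfolding l_def m_def n_def by algebra+
    \<comment> \<open>A critical point at infinity would be rational, making \<sigma> a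
      square.\<close>
    have n0: "n \<noteq> 0"
    proof
      assume "n = 0"
      then have "\<sigma> = (m / t)\<^sup>2" using lmn t0 by (simp add: power2_eq_square field_simps)
      then show False using \<sigma> by blast
    qed
    have n2: "2 * n * n * t \<noteq> 0" using two n0 t0 by simp
    \<comment> \<open>The spanning polynomials are \<open>(n x + m)^2 + \<sigma> t^2\<close> and
      \<open>2 t (n x + m)\<close>, the transformed numerator and denominator of the model.\<close>
    have row: "[:x0, x1, x2:]
       = smult ((2 * t * x2) / (2 * n * n * t)) [:\<sigma> * t\<^sup>2 + m\<^sup>2, 2 * n * m, n\<^sup>2:]
       + smult ((x1 * n - 2 * m * x2) / (2 * n * n * t)) [:2 * m * t, 2 * n * t, 0:]"
      if x: "x0 * n - x1 * m + x2 * l = 0" for x0 x1 x2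
    proof -
      have "x0 * (2 * n * n * t) = (2 * t * x2) * (\<sigma> * t\<^sup>2 + m\<^sup>2)
            + (x1 * n - 2 * m * x2) * (2 * m * t)"
        using x lmn by algebra
      moreover have "x1 * (2 * n * n * t) = (2 * t * x2) * (2 * n * m)
            + (x1 * n - 2 * m * x2) * (2 * n * t)" by algebra
      moreover have "x2 * (2 * n * n * t) = (2 * t * x2) * n\<^sup>2 + (x1 * n - 2 * m * x2) * 0" by algebra
      ultimately show ?thesis by (intro quadratic_combination n2)
    qed
    have det: "n * t - m * 0 \<noteq> 0" using n0 t0 by simp
    show "rat_equiv (quad a0 a1 a2 b0 b1 b2) ((rat_X\<^sup>2 + rat_const \<sigma>) / (2 * rat_X))"
      unfolding degree_2_model_eq_quad[OF two]
      by (rule rat_equiv_quadI[OF res ex0 det row[OF pa(1)] row[OF pa(2)]]) simp_all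
  }
qed

subsection \<open>Counting over a finite field\<close>

lemma card_eq_mult_card_fibres:
  assumes "finite A" "finite C" "f ` A \<subseteq> C" "\<And>c. c \<in> C \<Longrightarrow> card {x \<in> A. f x = c} = k"
  shows "card A = k * card C"
proof -
  have "card A = (\<Sum>c\<in>C. \<Sum>x\<in>{x \<in> A. f x = c}. 1)"
    using sum.group[OF assms(1-3), of "\<lambda>_. 1 :: nat"] by simp
  then show ?thesis using assms(4) by simp
qed

lemma card_nonzero: "card (UNIV - {0 :: 'a::{zero,finite}}) = CARD('a) - 1"
  by (simp add: card_Diff_singleton)

text \<open>If \<open>p\<close> is nonzero, it determines \<open>s\<close> from the rest; otherwise
  \<open>q\<close> is nonzero and determines \<open>r\<close>, while \<open>s\<close> is free. The
  number is the order of SL2 for every nonzero \<open>d\<close>.\<close>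

lemma card_determinant_eq:
  fixes d :: "'a::{field,finite}"
  assumes "d \<noteq> 0"
  shows "card {(p, q, r, s). p * s - q * r = d} = CARD('a) ^ 3 - CARD('a)"
proof -
  let ?U = "UNIV :: 'a set"
  let ?N = "UNIV - {0 :: 'a}"
  have eq: "{(p, q, r, s). p * s - q * r = d}
    = (\<lambda>(p, q, r). (p, q, r, (d + q * r) / p)) ` (?N \<times> ?U \<times> ?U)
      \<union> (\<lambda>(q, s). (0, q, - d / q, s)) ` (?N \<times> ?U)" (is "?L = ?A \<union> ?B")
  proof (intro equalityI subsetI)
    fix x assume "x \<in> ?L"
    then obtain p q r s where x: "x = (p, q, r, s)" and e: "p * s - q * r = d" by auto
    show "x \<in> ?A \<union> ?B"
    proof (cases "p = 0")
      case True
      then have "q \<noteq> 0" "r = - d / q" using e assms by (auto simp: field_simps)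
      then show ?thesis using True by (auto simp: x image_iff)
    next
      case False
      then have "s = (d + q * r) / p" using e by (auto simp: field_simps)
      then show ?thesis using False by (auto simp: x image_iff)
    qed
  qed (auto split: if_splits)
  have "card ?A = (CARD('a) - 1) * (CARD('a) * CARD('a))"
    by (subst card_image) (auto intro!: inj_onI simp: card_cartesian_product card_nonzero)
  moreover have "card ?B = (CARD('a) - 1) * CARD('a)"
    by (subst card_image) (auto intro!: inj_onI simp: card_cartesian_product card_nonzero)
  moreover have "card (?A \<union> ?B) = card ?A + card ?B" by (rule card_Un_disjoint) auto
  ultimately show ?thesis unfolding eq
    by (simp add: diff_mult_distrib power3_eq_cube)
qed

text \<open>A nonzero \<open>l\<close> determines \<open>n\<close>, while \<open>l = 0\<close>
  leaves a square root \<open>m\<close> of \<open>d\<close> and a free \<open>n\<close>. Keeping the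
  number of roots as a term serves squares and nonsquares alike.\<close>

lemma card_discriminant_eq:
  fixes d :: "'a::{field,finite}"
  shows "card {(l, m, n). m\<^sup>2 - l * n = d}
    = (CARD('a) - 1) * CARD('a) + card {y. y\<^sup>2 = d} * CARD('a)"
proof -
  let ?U = "UNIV :: 'a set"
  let ?N = "UNIV - {0 :: 'a}"
  have eq: "{(l, m, n). m\<^sup>2 - l * n = d}
    = (\<lambda>(l, m). (l, m, (m\<^sup>2 - d) / l)) ` (?N \<times> ?U)
      \<union> (\<lambda>(m, n). (0, m, n)) ` ({y. y\<^sup>2 = d} \<times> ?U)" (is "?L = ?A \<union> ?B")
  proof (intro equalityI subsetI)
    fix x assume "x \<in> ?L"
    then obtain l m n where x: "x = (l, m, n)" and e: "m\<^sup>2 - l * n = d" by auto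
    show "x \<in> ?A \<union> ?B"
    proof (cases "l = 0")
      case True
      then show ?thesis using e by (auto simp: x image_iff)
    next
      case False
      then have "n = (m\<^sup>2 - d) / l" using e by (auto simp: field_simps)
      then show ?thesis using False by (auto simp: x image_iff)
    qed
  qed (auto split: if_splits)
  have "card ?A = (CARD('a) - 1) * CARD('a)"
    by (subst card_image) (auto intro!: inj_onI simp: card_cartesian_product card_nonzero)
  moreover have "card ?B = card {y. y\<^sup>2 = d} * CARD('a)"
    by (subst card_image) (auto intro!: inj_onI simp: card_cartesian_product)
  moreover have "card (?A \<union> ?B) = card ?A + card ?B" by (rule card_Un_disjoint) auto
  ultimately show ?thesis unfolding eq by simp
qed

section \<open>Coefficient pairs, their minors and the expressions they represent\<close>

type_synonym 'a triple = "'a \<times> 'a \<times> 'a"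

fun minors :: "'a::field triple \<times> 'a triple \<Rightarrow> 'a triple" where
  "minors ((a0, a1, a2), (b0, b1, b2)) = (a0 * b1 - a1 * b0, a0 * b2 - a2 * b0, a1 * b2 - a2 * b1)"

text \<open>A quarter of the discriminant of \<open>l + 2 m x + n x\<^sup>2\<close>.\<close>

fun disc :: "'a::field triple \<Rightarrow> 'a" where
  "disc (l, m, n) = m\<^sup>2 - l * n"

fun pair_quad :: "'a::field triple \<times> 'a triple \<Rightarrow> 'a poly fract" where
  "pair_quad ((a0, a1, a2), (b0, b1, b2)) = quad a0 a1 a2 b0 b1 b2"

lemma disc_minors: "disc (minors ((a0, a1, a2), (b0, b1, b2))) = resultant a0 a1 a2 b0 b1 b2"
  by (simp add: resultant_def)

lemma card_minors_fibre:
  fixes c :: "'a::{field,finite} triple"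
  assumes "disc c \<noteq> 0"
  shows "card {ab. minors ab = c} = CARD('a) ^ 3 - CARD('a)"
proof -
  obtain l m n where c: "c = (l, m, n)" by (cases c)
  show ?thesis
    \<comment> \<open>If \<open>n \<noteq> 0\<close>, then \<open>a\<^sub>0\<close> and \<open>b\<^sub>0\<close> are determined by the other four coefficients, because both
      vectors are orthogonal to \<open>(n, - m, l)\<close>.\<close>
  proof (cases "n = 0")
    case False
    let ?f = "\<lambda>(p, q, r, s). (((p * m - q * l) / n, p, q), ((r * m - s * l) / n, r, s))"
    have "{ab. minors ab = c} = ?f ` {(p, q, r, s). p * s - q * r = n}"
    proof (intro equalityI subsetI)
      fix x assume x: "x \<in> {ab. minors ab = c}"
      obtain a0 a1 a2 b0 b1 b2 where x': "x = ((a0, a1, a2), (b0, b1, b2))" by (metis surj_pair)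
      have e: "l = a0 * b1 - a1 * b0" "m = a0 * b2 - a2 * b0" "n = a1 * b2 - a2 * b1"
        using x by (auto simp: x' c)
      have "a0 * n = a1 * m - a2 * l" "b0 * n = b1 * m - b2 * l" unfolding e by algebra+
      then have "a0 = (a1 * m - a2 * l) / n" "b0 = (b1 * m - b2 * l) / n"
        using False by (simp_all add: field_simps)
      then have "x = ?f (a1, a2, b1, b2)" by (simp add: x')
      moreover have "(a1, a2, b1, b2) \<in> {(p, q, r, s). p * s - q * r = n}" by (simp add: e)
      ultimately show "x \<in> ?f ` {(p, q, r, s). p * s - q * r = n}" by (rule image_eqI)
    next
      fix x assume "x \<in> ?f ` {(p, q, r, s). p * s - q * r = n}"
      then obtain p q r s where x: "x = ?f (p, q, r, s)" and e: "p * s - q * r = n" by auto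
      define u where "u = (p * m - q * l) / n"
      define v where "v = (r * m - s * l) / n"
      have uv: "u * n = p * m - q * l" "v * n = r * m - s * l" using False by (simp_all add: u_def v_def)
      have "(u * r - p * v) * n = l * n" "(u * s - q * v) * n = m * n" using uv e by algebra+
      then have "u * r - p * v = l" "u * s - q * v = m" using False by simp_all
      then show "x \<in> {ab. minors ab = c}" by (simp add: x c e u_def v_def)
    qed
    moreover have "inj_on ?f {(p, q, r, s). p * s - q * r = n}" by (auto intro!: inj_onI)
    ultimately show ?thesis using card_determinant_eq[OF False] by (simp add: card_image)
  next
    case True
    then have m0: "m \<noteq> 0" using assms by (auto simp: c)
    \<comment> \<open>Orthogonality to \<open>(0, - m, l)\<close> determines the middle column from
      the last one. The parameters are the outer columns, with determinant \<open>m\<close>.\<close>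
    let ?f = "\<lambda>(p, q, r, s). ((p, q * l / m, q), (r, s * l / m, s))"
    have "{ab. minors ab = c} = ?f ` {(p, q, r, s). p * s - q * r = m}"
    proof (intro equalityI subsetI)
      fix x assume x: "x \<in> {ab. minors ab = c}"
      obtain a0 a1 a2 b0 b1 b2 where x': "x = ((a0, a1, a2), (b0, b1, b2))" by (metis surj_pair)
      have e: "l = a0 * b1 - a1 * b0" "m = a0 * b2 - a2 * b0" "0 = a1 * b2 - a2 * b1"
        using x True by (auto simp: x' c)
      have "a1 * m = a2 * l" "b1 * m = b2 * l" using e by algebra+
      then have "a1 = a2 * l / m" "b1 = b2 * l / m"
        using m0 by (simp_all add: field_simps)
      then have "x = ?f (a0, a2, b0, b2)" by (simp add: x')
      moreover have "(a0, a2, b0, b2) \<in> {(p, q, r, s). p * s - q * r = m}" by (simp add: e)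
      ultimately show "x \<in> ?f ` {(p, q, r, s). p * s - q * r = m}" by (rule image_eqI)
    next
      fix x assume "x \<in> ?f ` {(p, q, r, s). p * s - q * r = m}"
      then obtain p q r s where x: "x = ?f (p, q, r, s)" and e: "p * s - q * r = m" by auto
      define u where "u = q * l / m"
      define v where "v = s * l / m"
      have uv: "u * m = q * l" "v * m = s * l" using m0 by (simp_all add: u_def v_def)
      have "(p * v - u * r) * m = l * m" "(u * s - q * v) * m = 0 * m" using uv e by algebra+
      then have "p * v - u * r = l" "u * s - q * v = 0" using m0 by (simp_all del: mult_zero_left)
      then show "x \<in> {ab. minors ab = c}" by (simp add: x c e True u_def v_def)
    qed
    moreover have "inj_on ?f {(p, q, r, s). p * s - q * r = m}" by (auto intro!: inj_onI)
    ultimately show ?thesis using card_determinant_eq[OF m0] by (simp add: card_image)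
  qed
qed

fun scale :: "'a::field \<Rightarrow> 'a triple \<times> 'a triple \<Rightarrow> 'a triple \<times> 'a triple" where
  "scale k ((a0, a1, a2), (b0, b1, b2)) = ((k * a0, k * a1, k * a2), (k * b0, k * b1, k * b2))"

lemma disc_minors_scale: "disc (minors (scale k ab)) = (k\<^sup>2)\<^sup>2 * disc (minors ab)"
proof -
  obtain a0 a1 a2 b0 b1 b2 where "ab = ((a0, a1, a2), (b0, b1, b2))" by (metis surj_pair)
  then show ?thesis by (simp only: scale.simps disc_minors resultant_smult)
qed

lemma pair_quad_eq_iff:
  assumes "disc (minors ab) \<noteq> 0" "disc (minors cd) \<noteq> 0"
  shows "pair_quad ab = pair_quad cd \<longleftrightarrow> (\<exists>k. k \<noteq> 0 \<and> cd = scale k ab)"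
proof -
  obtain a0 a1 a2 b0 b1 b2 where ab: "ab = ((a0, a1, a2), (b0, b1, b2))" by (metis surj_pair)
  obtain c0 c1 c2 d0 d1 d2 where cd: "cd = ((c0, c1, c2), (d0, d1, d2))" by (metis surj_pair)
  show ?thesis using assms unfolding ab cd disc_minors by (simp add: quad_eq_iff)
qed

text \<open>The pairs with discriminant in \<open>D\<close> are counted twice: along
  \<open>pair_quad\<close> the fibres are free orbits of nonzero scalars, along
  \<open>minors\<close> they are given by \<open>card_minors_fibre\<close>. Closure of
  \<open>D\<close> under square factors keeps the scalar orbits inside.\<close>

lemma card_pair_quad_image:
  fixes D :: "'a::{field,finite} set"
  assumes "0 \<notin> D" and D: "\<And>d k. k \<noteq> 0 \<Longrightarrow> d \<in> D \<Longrightarrow> k\<^sup>2 * d \<in> D"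
  shows "(CARD('a) - 1) * card (pair_quad ` {ab. disc (minors ab) \<in> D})
    = (CARD('a) ^ 3 - CARD('a)) * card {c. disc c \<in> D}"
proof -
  let ?S = "{ab. disc (minors ab) \<in> D}"
  have "card {x \<in> ?S. pair_quad x = R} = CARD('a) - 1" if "R \<in> pair_quad ` ?S" for R
  proof -
    from that obtain ab where ab: "disc (minors ab) \<in> D" "R = pair_quad ab" by auto
    then have nz: "disc (minors ab) \<noteq> 0" using assms(1) by auto
    have "{x \<in> ?S. pair_quad x = R} = (\<lambda>k. scale k ab) ` (UNIV - {0})"
    proof (intro equalityI subsetI)
      fix x assume "x \<in> {x \<in> ?S. pair_quad x = R}"
      then have "disc (minors x) \<noteq> 0" "pair_quad ab = pair_quad x" using ab assms(1) by auto
      then show "x \<in> (\<lambda>k. scale k ab) ` (UNIV - {0})" using pair_quad_eq_iff[OF nz] by auto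
    next
      fix x assume "x \<in> (\<lambda>k. scale k ab) ` (UNIV - {0})"
      then obtain k where k: "k \<noteq> 0" "x = scale k ab" by auto
      then have "disc (minors x) \<in> D" unfolding k(2) disc_minors_scale by (intro D) (use k ab in simp_all)
      moreover from this have "disc (minors x) \<noteq> 0" using assms(1) by auto
      then have "pair_quad ab = pair_quad x" using pair_quad_eq_iff[OF nz] k by blast
      ultimately show "x \<in> {x \<in> ?S. pair_quad x = R}" using ab by simp
    qed
    moreover have "inj (\<lambda>k. scale k ab)"
    proof (rule injI)
      fix k j assume e: "scale k ab = scale j ab"
      obtain a0 a1 a2 b0 b1 b2 where x: "ab = ((a0, a1, a2), (b0, b1, b2))" by (metis surj_pair)
      show "k = j" using e nz by (auto simp: x)
    qed
    then have "card ((\<lambda>k. scale k ab) ` (UNIV - {0})) = card (UNIV - {0 :: 'a})"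
      by (intro card_image) (rule inj_on_subset, auto)
    ultimately show ?thesis by (simp only: card_nonzero)
  qed
  then have "card ?S = (CARD('a) - 1) * card (pair_quad ` ?S)"
    by (intro card_eq_mult_card_fibres) auto
  moreover have "card ?S = (CARD('a) ^ 3 - CARD('a)) * card {c. disc c \<in> D}"
  proof (rule card_eq_mult_card_fibres)
    fix c assume "c \<in> {c. disc c \<in> D}"
    then have "disc c \<noteq> 0" "{x \<in> ?S. minors x = c} = {x. minors x = c}" using assms(1) by auto
    then show "card {x \<in> ?S. minors x = c} = CARD('a) ^ 3 - CARD('a)" using card_minors_fibre by simp
  qed auto
  ultimately show ?thesis by simp
qed

text \<open>Fibring over the value of \<open>disc\<close>; later \<open>r\<close> is 2 for nonzero
  squares and 0 for nonsquares.\<close>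

lemma card_disc:
  fixes D :: "'a::{field,finite} set"
  assumes "\<And>d. d \<in> D \<Longrightarrow> card {y. y\<^sup>2 = d} = r"
  shows "card {c. disc c \<in> D} = ((CARD('a) - 1) * CARD('a) + r * CARD('a)) * card D"
proof (rule card_eq_mult_card_fibres)
  fix d assume d: "d \<in> D"
  then have "{x \<in> {c. disc c \<in> D}. disc x = d} = {(l, m, n). m\<^sup>2 - l * n = d}" by auto
  then show "card {x \<in> {c. disc c \<in> D}. disc x = d} = (CARD('a) - 1) * CARD('a) + r * CARD('a)"
    using card_discriminant_eq[of d] assms[OF d] by simp
qed auto

section \<open>Squares and nonsquares in a finite field of odd characteristic\<close>

lemma card_square_roots:
  fixes y :: "'a::field"
  assumes "(2::'a) \<noteq> 0" "y \<noteq> 0"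
  shows "card {x. x\<^sup>2 = y\<^sup>2} = 2"
proof -
  have "y \<noteq> - y"
  proof
    assume "y = - y"
    then have "2 * y = 0" by (metis add.right_inverse mult_2)
    with assms show False by simp
  qed
  moreover have "{x. x\<^sup>2 = y\<^sup>2} = {y, - y}" by (auto simp: power2_eq_iff)
  ultimately show ?thesis by simp
qed

lemma card_nonzero_squares:
  assumes "(2::'a::{field,finite}) \<noteq> 0"
  shows "CARD('a) - 1 = 2 * card ((\<lambda>y::'a. y\<^sup>2) ` (UNIV - {0}))"
  unfolding card_nonzero[symmetric]
proof (rule card_eq_mult_card_fibres)
  fix c :: 'a assume "c \<in> (\<lambda>y. y\<^sup>2) ` (UNIV - {0})"
  then obtain y where y: "y \<noteq> 0" "c = y\<^sup>2" by auto
  then have "{x \<in> UNIV - {0}. x\<^sup>2 = c} = {x. x\<^sup>2 = y\<^sup>2}" by auto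
  then show "card {x \<in> UNIV - {0}. x\<^sup>2 = c} = 2" using card_square_roots[OF assms y(1)] by simp
qed auto

text \<open>Half of the nonzero elements are squares, and multiplication by \<sigma> maps them
  injectively to nonsquares, so the two halves exhaust everything by cardinality.\<close>

lemma nonzero_eq_squares_Un_nonsquares:
  fixes \<sigma> :: "'a::{field,finite}"
  assumes "(2::'a) \<noteq> 0" "\<nexists>y. \<sigma> = y\<^sup>2"
  defines "Q \<equiv> (\<lambda>y::'a. y\<^sup>2) ` (UNIV - {0})"
  shows "Q \<inter> (*) \<sigma> ` Q = {}" "Q \<union> (*) \<sigma> ` Q = UNIV - {0}" "card ((*) \<sigma> ` Q) = card Q"
proof -
  have \<sigma>0: "\<sigma> \<noteq> 0" using assms(2) by (metis zero_power2)
  show disj: "Q \<inter> (*) \<sigma> ` Q = {}"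
  proof (rule equals0I)
    fix x assume "x \<in> Q \<inter> (*) \<sigma> ` Q"
    then obtain y z where yz: "y \<noteq> 0" "x = y\<^sup>2" "z \<noteq> 0" "x = \<sigma> * z\<^sup>2" unfolding Q_def by blast
    then have "\<sigma> = (y / z)\<^sup>2" by (simp add: power_divide nonzero_eq_divide_eq)
    with assms(2) show False by blast
  qed
  show card: "card ((*) \<sigma> ` Q) = card Q" using \<sigma>0 by (intro card_image) (auto intro!: inj_onI)
  show "Q \<union> (*) \<sigma> ` Q = UNIV - {0}"
  proof (rule card_subset_eq)
    show "Q \<union> (*) \<sigma> ` Q \<subseteq> UNIV - {0}" using \<sigma>0 by (auto simp: Q_def)
    show "card (Q \<union> (*) \<sigma> ` Q) = card (UNIV - {0 :: 'a})"
      using disj card card_nonzero_squares[OF assms(1)]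
      by (subst card_Un_disjoint) (auto simp: card_nonzero Q_def)
  qed simp
qed

text \<open>Bridge from equivalence to counting: it brings the sets of the theorem into the form
  treated by \<open>card_pair_quad_image\<close>.\<close>

lemma rat_degree_2_set:
  fixes D :: "'a::field set"
  assumes "0 \<notin> D"
    and P: "\<And>a0 a1 a2 b0 b1 b2. resultant a0 a1 a2 b0 b1 b2 \<noteq> 0 \<Longrightarrow>
      P (quad a0 a1 a2 b0 b1 b2) \<longleftrightarrow> resultant a0 a1 a2 b0 b1 b2 \<in> D"
  shows "{R. rat_degree R = 2 \<and> P R} = pair_quad ` {ab. disc (minors ab) \<in> D}"
proof -
  have "P (pair_quad ab) \<longleftrightarrow> disc (minors ab) \<in> D" if "disc (minors ab) \<noteq> 0" for ab
  proof -
    obtain a0 a1 a2 b0 b1 b2 where ab: "ab = ((a0, a1, a2), (b0, b1, b2))" by (metis surj_pair)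
    show ?thesis using P that unfolding ab disc_minors pair_quad.simps by blast
  qed
  moreover have "rat_degree R = 2 \<longleftrightarrow> (\<exists>ab. disc (minors ab) \<noteq> 0 \<and> R = pair_quad ab)"
    for R :: "'a poly fract"
    unfolding rat_degree_eq_2_iff split_paired_Ex disc_minors pair_quad.simps ..
  moreover have "disc (minors ab) \<noteq> 0" if "disc (minors ab) \<in> D" for ab using that assms(1) by metis
  ultimately show ?thesis unfolding set_eq_iff mem_Collect_eq image_iff bex_simps by metis
qed

theorem theorem3p1:
  fixes \<sigma> :: "'a::{field,finite}" and q :: nat
  assumes "q = CARD('a)"
    and "odd CHAR('a)"
    and "\<sigma> \<noteq> 0" and "\<nexists>y. \<sigma> = y\<^sup>2"
  shows "card {R :: 'a poly fract. rat_degree R = 2} = q^3 * (q^2 - 1)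
       \<and> card {R :: 'a poly fract. rat_degree R = 2 \<and> rat_equiv R (rat_X\<^sup>2)}
           = q^2 * (q^2 - 1) * (q + 1) div 2
       \<and> card {R :: 'a poly fract. rat_degree R = 2 \<and>
               rat_equiv R ((rat_X\<^sup>2 + rat_const \<sigma>) / (2 * rat_X))}
           = q^2 * (q^2 - 1) * (q - 1) div 2"
proof -
  have two: "(2::'a) \<noteq> 0"
  proof
    assume "(2::'a) = 0"
    then have "CHAR('a) dvd 2" using of_nat_eq_0_iff_char_dvd[of 2, where 'a = 'a] by simp
    moreover have "CHAR('a) \<noteq> 1" by simp
    ultimately show False using assms(2) two_is_prime_nat by (metis even_numeral prime_nat_iff)
  qed
  define Q where "Q = (\<lambda>y::'a. y\<^sup>2) ` (UNIV - {0})"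
  define Q' where "Q' = (*) \<sigma> ` Q"
  define \<phi> where "\<phi> = (rat_X\<^sup>2 + rat_const \<sigma>) / (2 * rat_X)"
  have Q: "Q \<inter> Q' = {}" "Q \<union> Q' = UNIV - {0}" "card Q' = card Q"
    using nonzero_eq_squares_Un_nonsquares[OF two assms(4)] by (simp_all add: Q_def Q'_def)
  have Q0: "0 \<notin> Q" "0 \<notin> Q'" using Q(2) by auto
  have Q_iff: "d \<in> Q \<longleftrightarrow> (\<exists>t. d = t\<^sup>2)" "d \<in> Q' \<longleftrightarrow> (\<exists>t. d = \<sigma> * t\<^sup>2)" if "d \<noteq> 0" for d
    using that by (auto simp: Q_def Q'_def image_iff)
  \<comment> \<open>Squaring is two-to-one on the nonzero elements.\<close>
  have k: "q = 2 * card Q + 1"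
    using card_nonzero_squares[OF two] zero_less_card_finite[where 'a = 'a]
    unfolding assms(1) Q_def by linarith
  have "1 \<in> Q" unfolding Q_def by (rule image_eqI[of _ _ 1]) simp_all
  then have k0: "card Q > 0" by (auto simp: card_gt_0_iff)
  have sqQ: "j\<^sup>2 * d \<in> Q" if "j \<noteq> 0" "d \<in> Q" for j d
    using that by (auto simp: Q_def power_mult_distrib[symmetric])
  have sqQ': "j\<^sup>2 * d \<in> Q'" if "j \<noteq> 0" "d \<in> Q'" for j d
    using that sqQ by (auto simp: Q'_def mult.left_commute)
  have roots: "card {y. y\<^sup>2 = d} = 2" if "d \<in> Q" for d
    using that card_square_roots[OF two] by (auto simp: Q_def)
  have no_roots: "card {y. y\<^sup>2 = d} = 0" if "d \<in> Q'" for d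
  proof -
    have "d \<noteq> 0" "d \<notin> Q" using that Q Q0 by auto
    then have "{y. y\<^sup>2 = d} = {}" using Q_iff by auto
    then show ?thesis by simp
  qed
  have S1: "{R. rat_degree R = 2 \<and> rat_equiv R (rat_X\<^sup>2)} = pair_quad ` {ab. disc (minors ab) \<in> Q}"
    by (rule rat_degree_2_set[OF Q0(1)]) (simp only: quad_equiv_square_iff[OF two] Q_iff not_False_eq_True)
  have S2: "{R. rat_degree R = 2 \<and> rat_equiv R \<phi>} = pair_quad ` {ab. disc (minors ab) \<in> Q'}"
    unfolding \<phi>_def
    by (rule rat_degree_2_set[OF Q0(2)]) (simp only: quad_equiv_nonsquare_iff[OF two _ assms(4)] Q_iff not_False_eq_True)
  have S: "{R :: 'a poly fract. rat_degree R = 2} = pair_quad ` {ab. disc (minors ab) \<in> UNIV - {0}}"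
    using rat_degree_2_set[of "UNIV - {0}" "\<lambda>_. True"] by simp
  \<comment> \<open>As \<open>q - 1 = 2 * card Q\<close>, the positive factor \<open>card Q\<close>
    cancels and leaves the 2 behind the halving in the result.\<close>
  have cancel: "2 * c = x * y" if "(q - 1) * c = x * (y * card Q)" for c x y
  proof -
    have "card Q * (2 * c) = card Q * (x * y)" using that k by (simp add: mult_ac)
    then show ?thesis using k0 by (metis mult_cancel1 less_irrefl)
  qed
  define c1 where "c1 = card (pair_quad ` {ab. disc (minors ab) \<in> Q})"
  define c2 where "c2 = card (pair_quad ` {ab. disc (minors ab) \<in> Q'})"
  have "(q - 1) * c1 = (q ^ 3 - q) * (((q - 1) * q + 2 * q) * card Q)"
  proof -
    have "card {c. disc c \<in> Q} = ((q - 1) * q + 2 * q) * card Q"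
      unfolding assms(1) by (intro card_disc roots)
    moreover have "(q - 1) * c1 = (q ^ 3 - q) * card {c. disc c \<in> Q}"
      unfolding assms(1) c1_def by (intro card_pair_quad_image Q0 sqQ)
    ultimately show ?thesis by simp
  qed
  moreover have "(q - 1) * c2 = (q ^ 3 - q) * (((q - 1) * q + 0 * q) * card Q)"
  proof -
    have "card {c. disc c \<in> Q'} = ((q - 1) * q + 0 * q) * card Q'"
      unfolding assms(1) by (intro card_disc no_roots)
    moreover have "(q - 1) * c2 = (q ^ 3 - q) * card {c. disc c \<in> Q'}"
      unfolding assms(1) c2_def by (intro card_pair_quad_image Q0 sqQ')
    ultimately show ?thesis by (simp add: Q(3))
  qed
  ultimately have c: "2 * c1 = (q ^ 3 - q) * ((q - 1) * q + 2 * q)" "2 * c2 = (q ^ 3 - q) * ((q - 1) * q)"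
    by (simp_all only: cancel mult_zero_left add_0_right)
  have "{R :: 'a poly fract. rat_degree R = 2}
      = pair_quad ` {ab. disc (minors ab) \<in> Q} \<union> pair_quad ` {ab. disc (minors ab) \<in> Q'}"
    unfolding S Q(2)[symmetric] by blast
  \<comment> \<open>Equal expressions come from proportional pairs, whose discriminants differ by a
    nonzero square factor.\<close>
  moreover have "pair_quad ` {ab. disc (minors ab) \<in> Q} \<inter> pair_quad ` {ab. disc (minors ab) \<in> Q'} = {}"
  proof -
    have False if *: "disc (minors ab) \<in> Q" "disc (minors cd) \<in> Q'" "pair_quad ab = pair_quad cd" for ab cd
    proof -
      have "disc (minors ab) \<noteq> 0" "disc (minors cd) \<noteq> 0" using * Q0 by metis+
      then obtain j where "j \<noteq> 0" "cd = scale j ab" using *(3) pair_quad_eq_iff by blast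
      then have "disc (minors cd) \<in> Q" unfolding \<open>cd = _\<close> disc_minors_scale
        by (intro sqQ) (use * in simp_all)
      with *(2) Q(1) show False by blast
    qed
    then show ?thesis by blast
  qed
  ultimately have c12: "card {R :: 'a poly fract. rat_degree R = 2} = c1 + c2"
    unfolding c1_def c2_def by (simp only: card_Un_disjoint finite_imageI finite)
  have e: "q ^ 3 - q = q * (q\<^sup>2 - 1)"
    by (simp add: diff_mult_distrib2 power2_eq_square power3_eq_cube)
  have f: "(q - 1) * q + 2 * q = q * (q + 1)" unfolding k by (simp add: algebra_simps)
  \<comment> \<open>Exhibiting the products as doubles makes both divisions by 2 exact.\<close>
  have 1: "q\<^sup>2 * (q\<^sup>2 - 1) * (q + 1) = 2 * c1"
    unfolding c e f by (simp only: power2_eq_square mult_ac)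
  have 2: "q\<^sup>2 * (q\<^sup>2 - 1) * (q - 1) = 2 * c2"
    unfolding c e by (simp only: power2_eq_square mult_ac)
  have "2 * (c1 + c2) = q\<^sup>2 * (q\<^sup>2 - 1) * ((q + 1) + (q - 1))"
    by (simp only: add_mult_distrib2[of _ "q + 1" "q - 1"] add_mult_distrib2[of 2] 1 2)
  \<comment> \<open>The truncated subtraction is exact because \<open>k\<close> gives
    \<open>q \<ge> 1\<close>.\<close>
  also have "(q + 1) + (q - 1) = 2 * q" using k by simp
  also have "q\<^sup>2 * (q\<^sup>2 - 1) * (2 * q) = 2 * (q ^ 3 * (q\<^sup>2 - 1))"
    by (simp only: power2_eq_square power3_eq_cube mult_ac)
  finally have "c1 + c2 = q ^ 3 * (q\<^sup>2 - 1)" by simp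
  then show ?thesis unfolding c12 S1 S2[unfolded \<phi>_def] c1_def[symmetric] c2_def[symmetric] 1 2
    by simp
qed

end
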